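(* Let $(V,\omega)$ be a symplectic real vector space of dimension $2n$ with a fixed basis. The Lie algebra of the $\omega$-semisymplectic group $\Omega_n$ is the set $\mathfrak{sp}_{\omega}(n;\mathbb{R})$ of the $\omega$-Hamiltonian matrices.
   Context: A symplectic vector space $(V,\omega)$ is a finite-dimensional real vector space $V$ (of even dimension $2n$) with an alternating non-degenerate bilinear form $\omega:V\times V\to\mathbb{R}$. A (not necessarily symplectic) basis of $V$ is fixed and $[\omega]\in\mathbb{M}_{2n}(\mathbb{R})$ is the (skew-symmetric, invertible) matrix of $\omega$ in this basis, so $\omega(\mathbf u,\mathbf v)=\mathbf u^T[\omega]\mathbf v$ in coordinates. Let $Sp_{\omega}(n;\mathbb{R})=\{B\in\mathbb{M}_{2n}(\mathbb{R}): B^T[\omega]B=[\omega]\}$ and $Sp_{\omega}^{-1}(n;\mathbb{R})=\{B\in\mathbb{M}_{2n}(\mathbb{R}): B^T[\omega]B=-[\omega]\}$. The $\omega$-semisymplectic group is the disjoint union $\Omega_n=Sp_{\omega}(n;\mathbb{R})\,\dot\cup\, Sp_{\omega}^{-1}(n;\mathbb{R})$, a closed subgroup of $GL(2n)$, the group of invertible real $2n\times 2n$ matrices. The Lie algebra of a closed subgroup $G\subset GL(2n)$ is $\{L\in\mathbb{M}_{2n}(\mathbb{R}): \exp(tL)\in G\ \text{for all } t\in\mathbb{R}\}$. The set of $\omega$-Hamiltonian matrices is $\mathfrak{sp}_{\omega}(n;\mathbb{R})=\{L\in\mathbb{M}_{2n}(\mathbb{R}): L^T[\omega]+[\omega]L=0\}$.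 *)

theory Defs
  imports "HOL-Analysis.Analysis"
begin

section \<open>Symplectic vector spaces with a fixed basis\<close>

text \<open>
  The vector space is the whole type. Its finite dimension comes from the basis, which is indexed by
  a finite type.
\<close>

definition symplectic_form :: "('v::real_vector \<Rightarrow> 'v \<Rightarrow> real) \<Rightarrow> bool" where
  "symplectic_form \<omega> \<longleftrightarrow>
     bilinear \<omega> \<and> (\<forall>v. \<omega> v v = 0) \<and> (\<forall>u. (\<forall>v. \<omega> u v = 0) \<longrightarrow> u = 0)"

definition is_basis :: "('n::finite \<Rightarrow> 'v::real_vector) \<Rightarrow> bool" where
  "is_basis b \<longleftrightarrow> inj b \<and> independent (range b) \<and> span (range b) = UNIV"

definition form_matrix :: "('n::finite \<Rightarrow> 'v) \<Rightarrow> ('v \<Rightarrow> 'v \<Rightarrow> real) \<Rightarrow> real^'n^'n" where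
  "form_matrix b \<omega> = (\<chi> i j. \<omega> (b i) (b j))"

section \<open>The semisymplectic group and the Hamiltonian matrices\<close>

text \<open>The argument \<open>W\<close> is the matrix of the symplectic form in the fixed basis.\<close>

definition Sp :: "real^'n^'n \<Rightarrow> (real^'n^'n) set" where
  "Sp W = {B. transpose B ** W ** B = W}"

definition antiSp :: "real^'n^'n \<Rightarrow> (real^'n^'n) set" where
  "antiSp W = {B. transpose B ** W ** B = - W}"

definition semisymplectic :: "real^'n^'n \<Rightarrow> (real^'n^'n) set" where
  "semisymplectic W = Sp W \<union> antiSp W"

definition hamiltonian :: "real^'n^'n \<Rightarrow> (real^'n^'n) set" where
  "hamiltonian W = {L. transpose L ** W + W ** L = 0}"

section \<open>The Lie algebra of a closed matrix group\<close>

text \<open>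
  The constants \<open>(*)\<close>, \<open>(^)\<close> and \<open>exp\<close> cannot serve here: on the type of matrices the first two are
  componentwise, and the third is not available. The exponential series is summed in the Euclidean
  topology; it always converges, see \<open>summable_matrix_exp\<close> below.
\<close>

primrec matrix_power :: "real^'n^'n \<Rightarrow> nat \<Rightarrow> real^'n^'n" where
  "matrix_power A 0 = mat 1"
| "matrix_power A (Suc k) = A ** matrix_power A k"

definition matrix_exp :: "real^'n^'n \<Rightarrow> real^'n^'n" where
  "matrix_exp A = (\<Sum>k. (1 / fact k) *\<^sub>R matrix_power A k)"

definition closed_matrix_group :: "(real^'n^'n) set \<Rightarrow> bool" where
  "closed_matrix_group G \<longleftrightarrow>
     G \<subseteq> {A. invertible A} \<and> mat 1 \<in> G \<and> (\<forall>A\<in>G. \<forall>B\<in>G. A ** B \<in> G) \<and>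
     (\<forall>A\<in>G. matrix_inv A \<in> G) \<and> closedin (top_of_set {A. invertible A}) G"

text \<open>This is meant for \<open>G\<close> with \<open>closed_matrix_group G\<close>.\<close>

definition matrix_lie_algebra :: "(real^'n^'n) set \<Rightarrow> (real^'n^'n) set" where
  "matrix_lie_algebra G = {L. \<forall>t::real. matrix_exp (t *\<^sub>R L) \<in> G}"

section \<open>The definitions are meaningful\<close>

lemma bounded_bilinear_matrix_mult:
  "bounded_bilinear ((**) :: real^'n^'n \<Rightarrow> real^'n^'n \<Rightarrow> real^'n^'n)"
proof -
  have "bilinear ((**) :: real^'n^'n \<Rightarrow> real^'n^'n \<Rightarrow> real^'n^'n)"
    unfolding bilinear_def
    by (auto intro!: linearI simp: vec_eq_iff matrix_matrix_mult_def
        sum_distrib_left sum.distrib distrib_left distrib_right mult_ac)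
  then show ?thesis
    by (simp add: bilinear_conv_bounded_bilinear)
qed

lemma summable_matrix_exp:
  fixes A :: "real^'n^'n"
  shows "summable (\<lambda>k. (1 / fact k) *\<^sub>R matrix_power A k)"
proof -
  obtain K where K: "K > 0" "\<And>(A :: real^'n^'n) (B :: real^'n^'n). norm (A ** B) \<le> norm A * norm B * K"
    using bounded_bilinear.pos_bounded[OF bounded_bilinear_matrix_mult] by blast
  have bound: "norm (matrix_power A k) \<le> norm (mat 1 :: real^'n^'n) * (K * norm A) ^ k" for k
  proof (induction k)
    case (Suc k)
    have "norm (matrix_power A (Suc k)) \<le> norm A * norm (matrix_power A k) * K"
      using K(2) by simp
    also have "\<dots> \<le> norm A * (norm (mat 1 :: real^'n^'n) * (K * norm A) ^ k) * K"
      using Suc K(1) by (intro mult_right_mono mult_left_mono) auto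
    finally show ?case by (simp add: mult_ac)
  qed simp
  show ?thesis
  proof (rule summable_comparison_test')
    show "summable (\<lambda>k. norm (mat 1 :: real^'n^'n) * (inverse (fact k) * (K * norm A) ^ k))"
      by (intro summable_mult summable_exp)
    show "norm ((1 / fact k) *\<^sub>R matrix_power A k)
            \<le> norm (mat 1 :: real^'n^'n) * (inverse (fact k) * (K * norm A) ^ k)" if "k \<ge> 0" for k
      using bound[of k] by (simp add: field_simps)
  qed
qed

lemma form_matrix_coordinates:
  assumes "bilinear \<omega>"
  shows "\<omega> (\<Sum>i\<in>UNIV. x $ i *\<^sub>R b i) (\<Sum>j\<in>UNIV. y $ j *\<^sub>R b j) = x \<bullet> (form_matrix b \<omega> *v y)"
  unfolding bilinear_sum[OF assms] sum.cartesian_product[symmetric]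
  by (simp add: bilinear_lmul[OF assms] bilinear_rmul[OF assms]
      form_matrix_def inner_vec_def matrix_vector_mult_def sum_distrib_left mult_ac)

lemma basis_coordinates:
  fixes b :: "'n::finite \<Rightarrow> 'v::real_vector"
  assumes "is_basis b"
  obtains x :: "real^'n" where "v = (\<Sum>i\<in>UNIV. x $ i *\<^sub>R b i)"
proof -
  have "v \<in> span (range b)"
    using assms by (simp add: is_basis_def)
  then obtain u where "v = (\<Sum>w\<in>range b. u w *\<^sub>R w)"
    by (auto simp: span_finite)
  also have "\<dots> = (\<Sum>i\<in>UNIV. (\<chi> i. u (b i)) $ i *\<^sub>R b i)"
    using assms by (simp add: is_basis_def sum.reindex)
  finally show ?thesis ..
qed

lemma form_matrix_skew:
  assumes "symplectic_form \<omega>"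
  shows "transpose (form_matrix b \<omega>) = - form_matrix b \<omega>"
proof -
  have bil: "bilinear \<omega>" and alt: "\<And>v. \<omega> v v = 0"
    using assms by (auto simp: symplectic_form_def)
  have "\<omega> v u = - \<omega> u v" for u v
    using alt[of "u + v"] alt[of u] alt[of v]
    by (simp add: bilinear_ladd[OF bil] bilinear_radd[OF bil])
  then have "\<forall>i j. \<omega> (b j) (b i) = - \<omega> (b i) (b j)"
    by blast
  then show ?thesis
    unfolding vec_eq_iff transpose_def form_matrix_def vec_lambda_beta vector_uminus_component .
qed

lemma form_matrix_invertible:
  fixes b :: "'n::finite \<Rightarrow> 'v::real_vector"
  assumes "symplectic_form \<omega>" "is_basis b"
  shows "invertible (form_matrix b \<omega>)"
proof -
  have bil: "bilinear \<omega>"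
    and nd: "\<And>u. (\<And>v. \<omega> u v = 0) \<Longrightarrow> u = 0"
    using assms(1) by (auto simp: symplectic_form_def)
  have "x = 0" if "transpose (form_matrix b \<omega>) *v x = 0" for x
  proof -
    define u where "u = (\<Sum>i\<in>UNIV. x $ i *\<^sub>R b i)"
    have "\<omega> u v = 0" for v
    proof -
      obtain y where "v = (\<Sum>i\<in>UNIV. y $ i *\<^sub>R b i)"
        using basis_coordinates[OF assms(2)] .
      then have "\<omega> u v = x \<bullet> (form_matrix b \<omega> *v y)"
        by (simp add: u_def form_matrix_coordinates[OF bil])
      also have "\<dots> = 0"
        using that by (metis dot_lmul_matrix inner_zero_left transpose_matrix_vector)
      finally show ?thesis .
    qed
    then have "(\<Sum>i\<in>UNIV. x $ i *\<^sub>R b i) = 0"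
      using nd by (simp add: u_def)
    moreover have "(\<Sum>i\<in>UNIV. x $ i *\<^sub>R b i) = (\<Sum>w\<in>range b. x $ (inv b w) *\<^sub>R w)"
      using assms(2) by (simp add: is_basis_def sum.reindex)
    ultimately have "x $ (inv b w) = 0" if "w \<in> range b" for w
      using assms(2) that independentD[of "range b" "range b"] by (simp add: is_basis_def)
    then have "x $ i = 0" for i
      using assms(2) by (metis inv_f_f is_basis_def rangeI)
    then show "x = 0"
      by (simp add: vec_eq_iff)
  qed
  then have "invertible (transpose (form_matrix b \<omega>))"
    by (simp add: invertible_left_inverse matrix_left_invertible_ker)
  then show ?thesis
    by (simp add: invertible_det_nz)
qed

lemma Sp_antiSp_disjoint:
  fixes W :: "real^'n^'n"
  assumes "invertible W"
  shows "Sp W \<inter> antiSp W = {}"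
proof -
  obtain W' where "W ** W' = mat 1"
    using assms by (auto simp: invertible_def)
  moreover have "mat 1 \<noteq> (0 :: real^'n^'n)"
    by (auto simp: vec_eq_iff mat_def)
  ultimately have "W \<noteq> 0"
    using bounded_bilinear.zero_left[OF bounded_bilinear_matrix_mult, of W'] by force
  then have "W \<noteq> - W"
    by (auto simp: vec_eq_iff)
  then show ?thesis
    by (auto simp: Sp_def antiSp_def)
qed

lemma closed_matrix_group_semisymplectic:
  fixes W :: "real^'n^'n"
  assumes "invertible W"
  shows "closed_matrix_group (semisymplectic W)"
proof -
  have neg: "transpose B ** (- M) ** B = - (transpose B ** M ** B)" for B M :: "real^'n^'n"
    by (simp add: bounded_bilinear.minus_left[OF bounded_bilinear_matrix_mult]
        bounded_bilinear.minus_right[OF bounded_bilinear_matrix_mult])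
  have comp: "transpose (A ** B) ** W ** (A ** B) = transpose B ** (transpose A ** W ** A) ** B"
    for A B :: "real^'n^'n"
    by (simp add: matrix_transpose_mul matrix_mul_assoc)
  have one: "transpose (mat 1 :: real^'n^'n) = mat 1"
    by (simp add: transpose_mat)
  have in_iff: "B \<in> semisymplectic W \<longleftrightarrow>
      transpose B ** W ** B = W \<or> transpose B ** W ** B = - W" for B
    by (auto simp: semisymplectic_def Sp_def antiSp_def)
  have inv: "invertible B" if "B \<in> semisymplectic W" for B
  proof -
    have "det (transpose B ** W ** B) \<noteq> 0"
    proof -
      have "- W = (- 1) *\<^sub>R mat 1 ** W"
        by (simp add: bounded_bilinear.minus_left[OF bounded_bilinear_matrix_mult])
      moreover have "(- 1) *\<^sub>R mat 1 ** ((- 1) *\<^sub>R mat 1 ** W) = W"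
        by (simp add: bounded_bilinear.minus_left[OF bounded_bilinear_matrix_mult])
      ultimately have "det (- W) \<noteq> 0"
        using assms by (metis det_mul invertible_det_nz mult_zero_right)
      then show ?thesis
        using that assms unfolding in_iff by (auto simp: invertible_det_nz)
    qed
    then show ?thesis
      by (simp add: det_mul invertible_det_nz)
  qed
  have mul: "A ** B \<in> semisymplectic W" if "A \<in> semisymplectic W" "B \<in> semisymplectic W" for A B
    using that unfolding in_iff comp by (auto simp: neg)
  have invs: "matrix_inv A \<in> semisymplectic W" if A: "A \<in> semisymplectic W" for A
  proof -
    define C where "C = matrix_inv A"
    have AC: "A ** C = mat 1"
      using inv[OF A] unfolding C_def matrix_inv_def invertible_def
      by (rule someI2_ex) simp
    have W: "transpose C ** (transpose A ** W ** A) ** C = W"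
      using comp[of A C] by (simp add: AC one)
    from A consider "transpose A ** W ** A = W" | "transpose A ** W ** A = - W"
      unfolding in_iff by blast
    then have "transpose C ** W ** C = W \<or> transpose C ** W ** C = - W"
    proof cases
      case 1
      then show ?thesis using W by simp
    next
      case 2
      then have "- (transpose C ** W ** C) = W" using W neg by simp
      then show ?thesis by (metis minus_minus)
    qed
    then show ?thesis
      unfolding in_iff C_def .
  qed
  have cont: "continuous_on UNIV (\<lambda>B::real^'n^'n. transpose B ** W ** B)"
    unfolding matrix_matrix_mult_def transpose_def
    by (intro continuous_intros)
  have "closed {B. transpose B ** W ** B = W}" "closed {B. transpose B ** W ** B = - W}"
    by (intro closed_Collect_eq cont continuous_on_const)+
  then have "closed (semisymplectic W)"
    unfolding semisymplectic_def Sp_def antiSp_def by (rule closed_Un)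
  then have "closedin (top_of_set {A. invertible A}) (semisymplectic W)"
    using inv by (intro closed_subset) auto
  moreover have "mat 1 \<in> semisymplectic W"
    by (simp add: in_iff one)
  ultimately show ?thesis
    unfolding closed_matrix_group_def using inv mul invs by blast
qed

end

theory Submission
  imports Defs
begin

text \<open>
  For \<open>E t = exp (t L)\<close> the curve \<open>t \<mapsto> (E t)\<^sup>T W (E t)\<close> starts at \<open>W\<close> and has derivative
  \<open>(E t)\<^sup>T (L\<^sup>T W + W L) (E t)\<close>. If \<open>L\<close> is Hamiltonian, the curve is therefore constant. Conversely,
  if all \<open>E t\<close> are semisymplectic, the curve takes only the values \<open>W\<close> and \<open>- W\<close>; these are
  distinct, so by continuity the curve equals \<open>W\<close> near \<open>0\<close>, and its derivative
  \<open>L\<^sup>T W + W L\<close> there vanishes.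
\<close>

lemmas matrix_mult_linear_simps =
  bounded_bilinear.add_left[OF bounded_bilinear_matrix_mult]
  bounded_bilinear.add_right[OF bounded_bilinear_matrix_mult]
  bounded_bilinear.scaleR_left[OF bounded_bilinear_matrix_mult]
  bounded_bilinear.scaleR_right[OF bounded_bilinear_matrix_mult]
  bounded_bilinear.zero_left[OF bounded_bilinear_matrix_mult]
  bounded_bilinear.zero_right[OF bounded_bilinear_matrix_mult]

lemma matrix_power_scaleR:
  "matrix_power (t *\<^sub>R L) k = t ^ k *\<^sub>R matrix_power L k"
  by (induction k) (simp_all add: matrix_mult_linear_simps)

lemma bounded_linear_matrix_entry: "bounded_linear (\<lambda>A::real^'n^'m. A $ i $ j)"
  by (intro bounded_linear_compose[OF bounded_linear_vec_nth] bounded_linear_vec_nth)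

lemma bounded_linear_transpose: "bounded_linear (transpose :: real^'n^'m \<Rightarrow> real^'m^'n)"
  by (simp add: linear_conv_bounded_linear[symmetric] linear_iff transpose_def vec_eq_iff)

lemma matrix_exp_0: "matrix_exp (0 :: real^'n^'n) = mat 1"
proof -
  have "(1 / fact k) *\<^sub>R matrix_power (0 :: real^'n^'n) k = (if k = 0 then mat 1 else 0)" for k
    by (cases k) (simp_all add: matrix_mult_linear_simps)
  then show ?thesis
    unfolding matrix_exp_def
    using sums_unique[OF sums_single[of 0 "\<lambda>_. mat 1 :: real^'n^'n"], symmetric]
    by simp
qed

text \<open>Differentiability can be tested entry by entry, which turns a question about the matrix
  exponential into one about real power series.\<close>

lemma has_vector_derivative_matrixI:
  fixes f :: "real \<Rightarrow> real^'n^'m"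
  assumes "\<And>i j. ((\<lambda>t. f t $ i $ j) has_field_derivative D $ i $ j) (at t)"
  shows "(f has_vector_derivative D) (at t)"
  unfolding has_vector_derivative_def has_derivative_componentwise_within[of f]
  using assms
  by (auto simp: Basis_vec_def inner_axis has_real_derivative_iff_has_vector_derivative
      has_vector_derivative_def)

text \<open>Every entry of \<open>matrix_exp (t *\<^sub>R L)\<close> is a real power series in
  \<open>t\<close> that converges everywhere, so it may be differentiated term by term.\<close>

lemma has_vector_derivative_matrix_exp:
  "((\<lambda>t. matrix_exp (t *\<^sub>R L)) has_vector_derivative L ** matrix_exp (t *\<^sub>R L)) (at t)"
proof (rule has_vector_derivative_matrixI)
  fix i j
  define c where "c k = matrix_power L k $ i $ j / fact k" for k
  have entry: "((\<lambda>k. c k * s ^ k) sums (matrix_exp (s *\<^sub>R L) $ i $ j))" for s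
    using bounded_linear.sums[OF bounded_linear_matrix_entry summable_sums[OF summable_matrix_exp[of "s *\<^sub>R L"]], of i j]
    by (simp add: c_def matrix_power_scaleR matrix_exp_def mult_ac)
  have "(\<lambda>k. diffs c k * t ^ k) sums ((L ** matrix_exp (t *\<^sub>R L)) $ i $ j)"
  proof -
    \<comment> \<open>The factor k + 1 that differentiation brings down cancels against
      \<open>fact (Suc k)\<close>.\<close>
    have "diffs c k = matrix_power L (Suc k) $ i $ j / fact k" for k
      unfolding diffs_def c_def fact_Suc by (simp del: of_nat_Suc matrix_power.simps)
    \<comment> \<open>Left multiplication by \<open>L\<close> is bounded and linear, hence passes
      through the series and raises each power by one.\<close>
    moreover have "(\<lambda>k. L ** ((1 / fact k) *\<^sub>R matrix_power (t *\<^sub>R L) k)) sums (L ** matrix_exp (t *\<^sub>R L))"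
      unfolding matrix_exp_def
      by (intro bounded_linear.sums[OF bounded_bilinear.bounded_linear_right[OF bounded_bilinear_matrix_mult]]
          summable_sums summable_matrix_exp)
    from bounded_linear.sums[OF bounded_linear_matrix_entry this, of i j]
    have "(\<lambda>k. matrix_power L (Suc k) $ i $ j / fact k * t ^ k) sums ((L ** matrix_exp (t *\<^sub>R L)) $ i $ j)"
      by (simp add: matrix_power_scaleR matrix_mult_linear_simps mult_ac)
    ultimately show ?thesis
      by simp
  qed
  then have "(\<Sum>k. diffs c k * t ^ k) = (L ** matrix_exp (t *\<^sub>R L)) $ i $ j"
    by (rule sums_unique[symmetric])
  moreover have "(\<lambda>s. matrix_exp (s *\<^sub>R L) $ i $ j) = (\<lambda>s. \<Sum>k. c k * s ^ k)"
    using entry by (simp add: sums_iff)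
  moreover have "((\<lambda>s. \<Sum>k. c k * s ^ k) has_field_derivative (\<Sum>k. diffs c k * t ^ k)) (at t)"
    using entry by (intro termdiffs_strong_converges_everywhere) (auto simp: sums_iff)
  ultimately show "((\<lambda>s. matrix_exp (s *\<^sub>R L) $ i $ j) has_field_derivative
      (L ** matrix_exp (t *\<^sub>R L)) $ i $ j) (at t)"
    by simp
qed

text \<open>This is the product rule. The derivative of the exponential carries \<open>L\<close> on
  its left, and transposing moves \<open>transpose L\<close> to the right, so both factors end up
  next to \<open>W\<close>.\<close>

lemma has_vector_derivative_pullback_matrix_exp:
  "((\<lambda>t. transpose (matrix_exp (t *\<^sub>R L)) ** W ** matrix_exp (t *\<^sub>R L)) has_vector_derivative
     transpose (matrix_exp (t *\<^sub>R L)) ** (transpose L ** W + W ** L) ** matrix_exp (t *\<^sub>R L)) (at t)"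
proof -
  let ?E = "\<lambda>t. matrix_exp (t *\<^sub>R L)"
  note mult = bounded_bilinear.has_vector_derivative[OF bounded_bilinear_matrix_mult]
  have "((\<lambda>t. transpose (?E t)) has_vector_derivative transpose (L ** ?E t)) (at t)"
    by (intro bounded_linear.has_vector_derivative[OF bounded_linear_transpose]
        has_vector_derivative_matrix_exp)
  from mult[OF mult[OF this has_vector_derivative_const[of W]] has_vector_derivative_matrix_exp[of L]]
  show ?thesis
    by (simp add: matrix_mult_linear_simps matrix_transpose_mul matrix_mul_assoc add.commute)
qed

lemma matrix_exp_Sp_if_hamiltonian:
  assumes "L \<in> hamiltonian W"
  shows "matrix_exp (t *\<^sub>R L) \<in> Sp W"
proof -
  let ?F = "\<lambda>t. transpose (matrix_exp (t *\<^sub>R L)) ** W ** matrix_exp (t *\<^sub>R L)"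
  have "(?F has_vector_derivative 0) (at s within UNIV)" for s
    \<comment> \<open>The middle factor of the derivative vanishes because \<open>L\<close> is
      Hamiltonian.\<close>
    using has_vector_derivative_pullback_matrix_exp[of L W s] assms
    by (simp add: hamiltonian_def bounded_bilinear.zero_left[OF bounded_bilinear_matrix_mult]
        bounded_bilinear.zero_right[OF bounded_bilinear_matrix_mult])
  then obtain C where "\<And>s. ?F s = C"
    using has_vector_derivative_zero_constant[of UNIV ?F] by auto
  then have "?F t = ?F 0"
    by metis
  then show ?thesis
    by (simp add: Sp_def matrix_exp_0)
qed

lemma hamiltonian_if_matrix_exp_semisymplectic:
  assumes "invertible W" and "\<And>t::real. matrix_exp (t *\<^sub>R L) \<in> semisymplectic W"
  shows "L \<in> hamiltonian W"
proof -
  let ?F = "\<lambda>t. transpose (matrix_exp (t *\<^sub>R L)) ** W ** matrix_exp (t *\<^sub>R L)"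
  have F0: "?F 0 = W"
    by (simp add: matrix_exp_0)
  have deriv: "(?F has_vector_derivative transpose L ** W + W ** L) (at 0)"
    using has_vector_derivative_pullback_matrix_exp[of L W 0] by (simp add: matrix_exp_0)
  \<comment> \<open>If \<open>W\<close> were equal to \<open>- W\<close>, then \<open>mat 1\<close>
    would lie in both \<open>Sp W\<close> and \<open>antiSp W\<close>, which are disjoint for
    invertible \<open>W\<close>.\<close>
  have "mat 1 \<in> Sp W"
    by (simp add: Sp_def)
  then have "W \<noteq> - W"
    using Sp_antiSp_disjoint[OF assms(1)] by (auto simp: antiSp_def)
  moreover have "(?F \<longlongrightarrow> W) (at 0)"
    using has_vector_derivative_continuous[OF deriv] F0 by (simp add: continuous_within)
  ultimately have "\<forall>\<^sub>F t in at 0. ?F t \<noteq> - W"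
    by (rule tendsto_imp_eventually_ne[rotated])
  then have "\<forall>\<^sub>F t in at 0. ?F t = W"
  proof eventually_elim
    case (elim t)
    then show ?case
      using assms(2)[of t] by (auto simp: semisymplectic_def Sp_def antiSp_def)
  qed
  \<comment> \<open>The filter \<open>at 0\<close> omits the point 0 itself; \<open>F0\<close>
    supplies the value there, so the zero derivative of the constant \<open>W\<close> transfers to
    \<open>?F\<close>.\<close>
  then have "(?F has_vector_derivative 0) (at 0)"
    using F0 has_derivative_transform_eventually[of "\<lambda>_. W" "\<lambda>_. 0" 0 UNIV ?F]
    by (simp add: has_vector_derivative_def eq_commute)
  then have "transpose L ** W + W ** L = 0"
    using deriv vector_derivative_unique_at by blast
  then show ?thesis
    by (simp add: hamiltonian_def)
qed

theorem proposition3p10: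
  fixes \<omega> :: "'v::real_vector \<Rightarrow> 'v \<Rightarrow> real"
    and b :: "'n::finite \<Rightarrow> 'v"
    and n :: nat
  assumes "symplectic_form \<omega>"
    and "is_basis b"
    and "dim (UNIV :: 'v set) = 2 * n"
  shows "matrix_lie_algebra (semisymplectic (form_matrix b \<omega>)) = hamiltonian (form_matrix b \<omega>)"
  \<comment> \<open>Non-degeneracy of the form enters through the invertibility of its matrix, which
    the inclusion of the Lie algebra in the Hamiltonian matrices uses.\<close>
  using matrix_exp_Sp_if_hamiltonian
    hamiltonian_if_matrix_exp_semisymplectic[OF form_matrix_invertible[OF assms(1,2)]]
  by (auto simp: matrix_lie_algebra_def semisymplectic_def)

end
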